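(* Let $\mathcal{C}$ be an $[n,K,d_{\min},\alpha,\kappa]$ vector code over $\mathbb{F}_q$ belonging to the class $\mathcal{U}$, i.e. possessing exact $(r,\delta)$ information locality with $\delta\ge2$ and with all local codes being uniform rank accumulation (URA) codes with common rank accumulation profile $\{a_i : 1\le i\le n_L\}$, $n_L=r+\delta-1$. Let $K_L=\sum_{i=1}^{n_L}a_i$. Then $$d_{\min}\ \le\ n-P^{(\mathrm{inv})}(K)+1 .$$ When $K_L\mid K$, the bound takes the form $$d_{\min}\ \le\ n-\left(\frac{K}{K_L}\right)r+1-\left(\frac{K}{K_L}-1\right)(\delta-1).$$
   Context: Vector codes. An $\mathbb{F}_q$-linear vector code $\mathcal{C}$ of block length $n$ with vector-size parameter $\alpha\ge1$ is an $\mathbb{F}_q$-linear subspace of $(\mathbb{F}_q^\alpha)^n$. Its scalar dimension is $K=\dim_{\mathbb{F}_q}\mathcal{C}$. Expanding each vector symbol into $\alpha$ scalars gives a scalar code of length $n\alpha$ with $K\times n\alpha$ generator matrix $G$; the columns $(i-1)\alpha+1,\dots,i\alpha$ form the $i$-th thick column of $G$. Standing assumption: the $\alpha$ columns in each thick column are linearly independent. For $S\subseteq[n]$, $G|_S$ is the restriction of $G$ to the thick columns indexed by $S$, and $\mathcal{C}|_S$ is the code punctured to (restricted to) $S$. The minimum distance $d_{\min}$ is the minimum Hamming weight, counted in vector symbols, of a nonzero codeword. An information set is a set $\mathcal{I}\subseteq[n]$ with $\mathrm{rank}(G|_{\mathcal{I}})=K$ such that no proper subset has this property; the quasi-dimension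 $\kappa$ is the minimum cardinality of an information set. Such a code is called an $[n,K,d_{\min},\alpha,\kappa]$ code. Exact locality. $\mathcal{C}$ has exact $(r,\delta)$ information locality if there are punctured codes $\mathcal{C}_i=\mathcal{C}|_{S_i}$, $i\in\mathcal{L}$ (the local codes), with $|S_i|=r+\delta-1$ and $d_{\min}(\mathcal{C}_i)=\delta$ for all $i\in\mathcal{L}$, and $\mathrm{Rank}(G|_{\cup_{i\in\mathcal{L}}S_i})=K$. URA codes. A vector code of block length $N$ with generator matrix $G'$ is a URA code with rank accumulation profile $\{a_1,\dots,a_N\}$ (non-negative integers) if for every $i\in[N]$ and every set $S$ of $i$ thick columns, $\mathrm{rank}(G'|_S)=\sum_{j=1}^i a_j$. The function $P^{(\mathrm{inv})}$. Extend $(a_1,\dots,a_{n_L})$ to a periodic sequence by $a_{i+jn_L}=a_i$ for $1\le i\le n_L$, $j\ge1$. Let $P(s)=\sum_{i=1}^s a_i$ for $s\ge1$ and $P(0)=0$. For an integer $\nu\ge1$, $P^{(\mathrm{inv})}(\nu)$ is the smallest integer $s$ with $P(s)\ge\nu$. *)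

theory Defs
  imports "HOL-Analysis.Analysis"
begin

text \<open>
  A word of block length \<open>CARD('n)\<close> with vector symbols of size \<open>CARD('\<alpha>)\<close> over the field
  \<open>'a\<close> is an element of \<open>('a^'\<alpha>)^'n\<close>. The library's scalar multiplication \<open>*s\<close> on this type
  has scalars in \<open>'a^'\<alpha>\<close>, so scaling by field elements is introduced separately.
\<close>

definition wscale :: "'a::field \<Rightarrow> 'a^'\<alpha>^'n \<Rightarrow> 'a^'\<alpha>^'n" where
  "wscale c x = (\<chi> i. c *s x $ i)"

interpretation word: vector_space "wscale :: 'a::field \<Rightarrow> 'a^'\<alpha>^'n \<Rightarrow> 'a^'\<alpha>^'n"
  by unfold_locales (simp_all add: wscale_def vec_eq_iff algebra_simps)

text \<open>
  The restriction of a word to a set \<open>S\<close> of block positions. It is kept in the ambient type by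
  filling the positions outside \<open>S\<close> with zeros; a code of block length \<open>card S\<close> with positions
  \<open>S\<close> is thus a code all of whose words vanish outside \<open>S\<close>. Linear dimension and Hamming
  weight are those of the shortened tuples.
\<close>

definition restrict_word :: "'n set \<Rightarrow> 'a::field^'\<alpha>^'n \<Rightarrow> 'a^'\<alpha>^'n" where
  "restrict_word S x = (\<chi> i. if i \<in> S then x $ i else 0)"

definition punctured_code :: "('a::field^'\<alpha>^'n) set \<Rightarrow> 'n set \<Rightarrow> ('a^'\<alpha>^'n) set" where
  "punctured_code C S = restrict_word S ` C"

definition vector_code_on :: "'n set \<Rightarrow> ('a::field^'\<alpha>^'n) set \<Rightarrow> bool" where
  "vector_code_on I C \<longleftrightarrow> word.subspace C \<and> (\<forall>x\<in>C. \<forall>i. i \<notin> I \<longrightarrow> x $ i = 0)"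

definition hamming_weight :: "'a::field^'\<alpha>^'n \<Rightarrow> nat" where
  "hamming_weight x = card {i. x $ i \<noteq> 0}"

text \<open>For the zero code, which has no minimum distance, the value is \<open>Inf {} = 0\<close>.\<close>

definition min_distance :: "('a::field^'\<alpha>^'n) set \<Rightarrow> nat" where
  "min_distance C = Inf (hamming_weight ` (C - {0}))"

text \<open>
  A matrix with \<open>K\<close> rows and one thick column per block position is given by its rows
  \<open>G 0, \<dots>, G (K - 1)\<close>; values of \<open>G\<close> from \<open>K\<close> on are irrelevant. The entry in row \<open>k\<close> and in
  the \<open>j\<close>-th column of the thick column \<open>i\<close> is \<open>G k $ i $ j\<close>.
\<close>

definition generator_matrix ::
    "('a::field^'\<alpha>^'n) set \<Rightarrow> nat \<Rightarrow> (nat \<Rightarrow> 'a^'\<alpha>^'n) \<Rightarrow> bool" where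
  "generator_matrix C K G \<longleftrightarrow>
     inj_on G {..<K} \<and> \<not> word.dependent (G ` {..<K}) \<and> word.span (G ` {..<K}) = C"

text \<open>The rank of \<open>G|\<^sub>S\<close>, as the dimension of its rows (cf. \<open>row_rank_def_gen\<close>).\<close>

definition thick_rank :: "nat \<Rightarrow> (nat \<Rightarrow> 'a::field^'\<alpha>^'n) \<Rightarrow> 'n set \<Rightarrow> nat" where
  "thick_rank K G S = word.dim (restrict_word S ` G ` {..<K})"

text \<open>Linear independence of the family of scalar columns inside each thick column.\<close>

definition thick_columns_independent :: "nat \<Rightarrow> (nat \<Rightarrow> 'a::field^'\<alpha>^'n) \<Rightarrow> bool" where
  "thick_columns_independent K G \<longleftrightarrow>
     (\<forall>i. \<forall>c :: '\<alpha> \<Rightarrow> 'a.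
        (\<forall>k<K. (\<Sum>j\<in>UNIV. c j * G k $ i $ j) = 0) \<longrightarrow> (\<forall>j. c j = 0))"

definition information_set :: "nat \<Rightarrow> (nat \<Rightarrow> 'a::field^'\<alpha>^'n) \<Rightarrow> 'n set \<Rightarrow> bool" where
  "information_set K G I \<longleftrightarrow>
     thick_rank K G I = K \<and> (\<forall>J. J \<subset> I \<longrightarrow> thick_rank K G J \<noteq> K)"

definition quasi_dimension :: "nat \<Rightarrow> (nat \<Rightarrow> 'a::field^'\<alpha>^'n) \<Rightarrow> nat" where
  "quasi_dimension K G = Inf (card ` {I. information_set K G I})"

text \<open>\<open>C\<close> is an \<open>[n, K, d, \<alpha>, \<kappa>]\<close> code with generator matrix \<open>G\<close>.\<close>

definition vector_code ::
    "('a::field^'\<alpha>^'n) set \<Rightarrow> (nat \<Rightarrow> 'a^'\<alpha>^'n) \<Rightarrow> nat \<Rightarrow> nat \<Rightarrow> nat \<Rightarrow> nat \<Rightarrow> nat \<Rightarrow> bool" where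
  "vector_code C G n K d \<alpha> \<kappa> \<longleftrightarrow>
     vector_code_on UNIV C \<and> n = CARD('n) \<and> K = word.dim C \<and> d = min_distance C \<and>
     \<alpha> = CARD('\<alpha>) \<and> generator_matrix C K G \<and> thick_columns_independent K G \<and>
     \<kappa> = quasi_dimension K G"

text \<open>Exact \<open>(r, \<delta>)\<close> information locality, with local codes supported on \<open>S i\<close> for \<open>i \<in> L\<close>.\<close>

definition exact_information_locality ::
    "('a::field^'\<alpha>^'n) set \<Rightarrow> nat \<Rightarrow> (nat \<Rightarrow> 'a^'\<alpha>^'n) \<Rightarrow> nat \<Rightarrow> nat \<Rightarrow>
     'l set \<Rightarrow> ('l \<Rightarrow> 'n set) \<Rightarrow> bool" where
  "exact_information_locality C K G r \<delta> L S \<longleftrightarrow>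
     (\<forall>i\<in>L. card (S i) = r + \<delta> - 1 \<and> min_distance (punctured_code C (S i)) = \<delta>) \<and>
     thick_rank K G (\<Union>i\<in>L. S i) = K"

text \<open>
  \<open>D\<close> is a URA code with block positions \<open>I\<close> (hence block length \<open>card I\<close>) and rank accumulation
  profile \<open>a 1, \<dots>, a (card I)\<close>.
\<close>

definition URA_code :: "'n set \<Rightarrow> ('a::field^'\<alpha>^'n) set \<Rightarrow> (nat \<Rightarrow> nat) \<Rightarrow> bool" where
  "URA_code I D a \<longleftrightarrow>
     vector_code_on I D \<and>
     (\<exists>k G'. generator_matrix D k G' \<and>
        (\<forall>i\<in>{1..card I}. \<forall>T. T \<subseteq> I \<and> card T = i \<longrightarrow> thick_rank k G' T = (\<Sum>j=1..i. a j)))"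

definition periodic_ext :: "(nat \<Rightarrow> nat) \<Rightarrow> nat \<Rightarrow> nat \<Rightarrow> nat" where
  "periodic_ext a N i = a ((i - 1) mod N + 1)"

definition P_sum :: "(nat \<Rightarrow> nat) \<Rightarrow> nat \<Rightarrow> nat \<Rightarrow> nat" where
  "P_sum a N s = (\<Sum>i=1..s. periodic_ext a N i)"

definition P_inv :: "(nat \<Rightarrow> nat) \<Rightarrow> nat \<Rightarrow> nat \<Rightarrow> nat" where
  "P_inv a N \<nu> = (LEAST s. P_sum a N s \<ge> \<nu>)"

end

theory Submission
  imports Defs
begin

text \<open>
  Write \<open>\<rho> T\<close> for the dimension of the code restricted to the block positions \<open>T\<close>; it is
  submodular. Restricted to one local code \<open>S i\<close> it is \<open>P (card T)\<close>, so submodularity makes the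
  periodic function \<open>P\<close> subadditive. Adjoin local codes \<open>S i\<close> one after the other, maintaining
  \<open>\<rho> U + P y \<le> P (card U + y)\<close> for all \<open>y\<close>. Submodularity preserves this invariant also when
  \<open>S i\<close> meets \<open>U\<close>, and it allows the last \<open>S i\<close> to be adjoined only partially, so there are sets
  \<open>T\<close> of any size \<open>s\<close> with \<open>P s < K\<close> such that \<open>\<rho> T \<le> P s\<close>. For \<open>s = P_inv K - 1\<close> some nonzero
  codeword vanishes on \<open>T\<close>, which bounds the minimum distance.
\<close>

section \<open>Periodic partial sums \<open>P_sum\<close>, their inverse and their
  subadditivity\<close>

lemma P_sum_0 [simp]: "P_sum a N 0 = 0"
  by (simp add: P_sum_def)

lemma P_sum_mono: "s \<le> t \<Longrightarrow> P_sum a N s \<le> P_sum a N t"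
  unfolding P_sum_def by (intro sum_mono2) auto

lemma P_sum_eq_sum:
  assumes "t \<le> N"
  shows "P_sum a N t = (\<Sum>i=1..t. a i)"
  unfolding P_sum_def periodic_ext_def using assms by (intro sum.cong) auto

lemma P_sum_add_period:
  assumes "N > 0"
  shows "P_sum a N (N + x) = P_sum a N N + P_sum a N x"
proof (induction x)
  case (Suc x)
  have "periodic_ext a N (Suc (N + x)) = periodic_ext a N (Suc x)"
    by (simp add: periodic_ext_def)
  with Suc show ?case
    by (simp add: P_sum_def)
qed simp

lemma P_sum_mult_period_add:
  assumes "N > 0"
  shows "P_sum a N (q * N + x) = q * P_sum a N N + P_sum a N x"
  by (induction q) (simp_all add: P_sum_add_period[OF assms] add.assoc)

text \<open>The assumption makes the set under \<open>LEAST\<close> nonempty; sums that never reach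
  \<nu> would leave \<open>P_inv\<close> unspecified. Monotonicity then makes \<open>P_inv\<close> a
  lower adjoint of \<open>P_sum\<close>.\<close>

lemma P_inv_le_iff:
  assumes "P_sum a N t \<ge> \<nu>"
  shows "P_inv a N \<nu> \<le> s \<longleftrightarrow> P_sum a N s \<ge> \<nu>"
  by (metis P_inv_def LeastI Least_le P_sum_mono assms order_trans)

text \<open>For arguments up to \<open>N\<close>, submodularity is applied to two subsets of
  \<open>S\<close> of these sizes with the least possible overlap. Periodicity extends the
  inequality to all arguments.\<close>

lemma P_sum_subadditive:
  fixes \<rho> :: "'n set \<Rightarrow> nat"
  assumes submod: "\<And>A B. \<rho> (A \<union> B) + \<rho> (A \<inter> B) \<le> \<rho> A + \<rho> B"
    and fin: "finite S" and card: "card S = N" and "N > 0"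
    and uniform: "\<And>T. T \<subseteq> S \<Longrightarrow> \<rho> T = P_sum a N (card T)"
  shows "P_sum a N (x + m) \<le> P_sum a N x + P_sum a N m"
proof -
  let ?P = "P_sum a N"
  have base: "?P (t + u) \<le> ?P t + ?P u" if tu: "t \<le> N" "u \<le> N" for t u
  proof -
    obtain A where A: "A \<subseteq> S" "card A = t"
      using tu card by (metis obtain_subset_with_card_n)
    have finA: "finite A" "finite (S - A)" "card (S - A) = N - t"
      using A fin card by (auto simp: card_Diff_subset finite_subset)
    show ?thesis
    proof (cases "t + u \<le> N")
      case True
      then obtain B where B: "B \<subseteq> S - A" "card B = u"
        using finA by (metis obtain_subset_with_card_n le_diff_conv2 add.commute tu(1))
      then have "A \<inter> B = {}" "card (A \<union> B) = t + u"
        using A finA card_Un_disjoint[of A B] finite_subset[OF B(1)] by auto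
      moreover have "\<rho> (A \<union> B) + \<rho> (A \<inter> B) \<le> \<rho> A + \<rho> B"
        by (rule submod)
      moreover have "A \<union> B \<subseteq> S" "B \<subseteq> S"
        using A B by auto
      ultimately show ?thesis
        using A B uniform[of A] uniform[of B] uniform[of "A \<union> B"] uniform[of "{}"] by simp
    next
      case False
      \<comment> \<open>Subsets of \<open>S\<close> of sizes \<open>t\<close> and \<open>u\<close>
        share at least \<open>v\<close> elements. \<open>B\<close> shares exactly \<open>v\<close>
        with \<open>A\<close> and covers the rest, so union and intersection together have rank
        \<open>P_sum a N (N + v)\<close>.\<close>
      define v where "v = t + u - N"
      then have "v \<le> card A"
        using A tu by simp
      then obtain D where D: "D \<subseteq> A" "card D = v"
        by (meson obtain_subset_with_card_n)
      define B where "B = (S - A) \<union> D"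
      have "finite D"
        using D finA finite_subset by blast
      then have "card B = u"
        unfolding B_def using finA D False tu v_def by (subst card_Un_disjoint) auto
      moreover have "A \<union> B = S" "A \<inter> B = D" "B \<subseteq> S"
        using A D by (auto simp: B_def)
      moreover have "\<rho> (A \<union> B) + \<rho> (A \<inter> B) \<le> \<rho> A + \<rho> B"
        by (rule submod)
      ultimately have "?P N + ?P v \<le> ?P t + ?P u"
        using A D card uniform[of A] uniform[of B] uniform[of S] uniform[of D] by simp
      moreover have "t + u = N + v"
        using False by (simp add: v_def)
      ultimately show ?thesis
        using P_sum_add_period[OF \<open>N > 0\<close>, of a v] by simp
    qed
  qed
  have split: "?P (q * N + y) = q * ?P N + ?P y" for q y
    by (rule P_sum_mult_period_add) fact
  \<comment> \<open>Full periods contribute equally to both sides, so \<open>base\<close> for the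
    remainders suffices.\<close>
  have "?P (x + m) = ?P ((x div N + m div N) * N + (x mod N + m mod N))"
    by (rule arg_cong[of _ _ ?P]) (simp add: algebra_simps)
  also have "\<dots> = (x div N + m div N) * ?P N + ?P (x mod N + m mod N)"
    by (rule split)
  also have "\<dots> \<le> (x div N * ?P N + ?P (x mod N)) + (m div N * ?P N + ?P (m mod N))"
    using base[of "x mod N" "m mod N"] \<open>N > 0\<close> by (simp add: algebra_simps less_imp_le)
  also have "\<dots> = ?P x + ?P m"
    unfolding split[symmetric] by simp
  finally show ?thesis .
qed

section \<open>Growing a position set of controlled rank\<close>

lemma exists_set_of_bounded_rank:
  fixes \<rho> :: "'n::finite set \<Rightarrow> nat"
  assumes submod: "\<And>A B. \<rho> (A \<union> B) + \<rho> (A \<inter> B) \<le> \<rho> A + \<rho> B"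
    and mono: "\<And>A B. A \<subseteq> B \<Longrightarrow> \<rho> A \<le> \<rho> B"
    and empty: "\<rho> {} = 0"
    and card: "\<And>i. i \<in> L \<Longrightarrow> card (S i) = N" and "N > 0"
    and uniform: "\<And>i T. i \<in> L \<Longrightarrow> T \<subseteq> S i \<Longrightarrow> \<rho> T = P_sum a N (card T)"
    and less: "P_sum a N s < \<rho> (\<Union>i\<in>L. S i)"
  shows "\<exists>T. card T = s \<and> \<rho> T \<le> P_sum a N s"
proof -
  let ?P = "P_sum a N"
  \<comment> \<open>The case \<open>y = 0\<close> bounds the rank of \<open>U\<close>; larger
    \<open>y\<close> provide for the positions still to be adjoined.\<close>
  define good where "good U \<longleftrightarrow> (\<forall>y. \<rho> U + ?P y \<le> ?P (card U + y)) \<and> card U \<le> s" for U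
  have "good {}"
    by (simp add: good_def empty)
  moreover have "\<forall>U. good U \<longrightarrow> card U < Suc s"
    by (simp add: good_def less_Suc_eq_le)
  ultimately obtain U where U: "good U" and U_max: "\<And>V. good V \<Longrightarrow> card V \<le> card U"
    using ex_has_greatest_nat[of good "{}" card "Suc s"] by metis
  have U_inv: "\<rho> U + ?P y \<le> ?P (card U + y)" for y
    using U by (simp add: good_def)
  have "card U \<le> s"
    using U by (simp add: good_def)
  then have "\<rho> U < \<rho> (\<Union>i\<in>L. S i)"
    using U_inv[of 0] P_sum_mono[of "card U" s a N] less by simp
  then have "\<not> (\<Union>i\<in>L. S i) \<subseteq> U"
    using mono by (meson leD)
  then obtain i where i: "i \<in> L" "\<not> S i \<subseteq> U"
    by blast
  have subadd: "?P (x + m) \<le> ?P x + ?P m" for x m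
    using submod \<open>N > 0\<close> card[OF i(1)] uniform[OF i(1)]
    by (intro P_sum_subadditive[where \<rho> = \<rho> and S = "S i"]) auto
  define m where "m = card (U \<inter> S i)"
  \<comment> \<open>Submodularity is applied to \<open>U\<close> and
    \<open>U \<inter> S i \<union> V\<close>. The latter and the intersection
    \<open>U \<inter> S i\<close> lie in one local set, so their ranks are values of
    \<open>P_sum\<close>.\<close>
  have rank_Un: "\<rho> (U \<union> V) + ?P m \<le> \<rho> U + ?P (m + card V)" if V: "V \<subseteq> S i - U" for V
  proof -
    have "card (U \<inter> S i \<union> V) = m + card V"
      unfolding m_def using V by (intro card_Un_disjoint) auto
    moreover have "\<rho> (U \<union> (U \<inter> S i \<union> V)) + \<rho> (U \<inter> (U \<inter> S i \<union> V))
        \<le> \<rho> U + \<rho> (U \<inter> S i \<union> V)"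
      by (rule submod)
    moreover have "U \<union> (U \<inter> S i \<union> V) = U \<union> V" "U \<inter> (U \<inter> S i \<union> V) = U \<inter> S i"
      using V by auto
    moreover have "U \<inter> S i \<subseteq> S i" "U \<inter> S i \<union> V \<subseteq> S i"
      using V by auto
    ultimately show ?thesis
      using uniform[OF i(1)] by (simp add: m_def)
  qed
  have card_Un: "card (U \<union> V) = card U + card V" if "V \<subseteq> S i - U" for V
    using that by (intro card_Un_disjoint) auto
  have card_m: "m + card (S i - U) = N"
  proof -
    have "m + card (S i - U) = card (U \<inter> S i \<union> (S i - U))"
      unfolding m_def by (intro card_Un_disjoint[symmetric]) auto
    moreover have "U \<inter> S i \<union> (S i - U) = S i"
      by auto
    ultimately show ?thesis
      using card[OF i(1)] by simp
  qed
  \<comment> \<open>If all of \<open>S i\<close> still fitted, adjoining it would give a strictly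
    larger good set, against the choice of \<open>U\<close>.\<close>
  have "card U + card (S i - U) > s"
  proof (rule ccontr)
    assume "\<not> ?thesis"
    then have "card (U \<union> (S i - U)) \<le> s"
      using card_Un[of "S i - U"] by simp
    moreover have "\<rho> (U \<union> (S i - U)) + ?P y \<le> ?P (card (U \<union> (S i - U)) + y)" for y
    proof -
      have "\<rho> (U \<union> (S i - U)) + ?P m \<le> \<rho> U + ?P N"
        using rank_Un[of "S i - U"] card_m by simp
      moreover have "\<rho> U + ?P (card (S i - U) + y) \<le> ?P (card U + (card (S i - U) + y))"
        by (rule U_inv)
      \<comment> \<open>One period plus \<open>y\<close> is split at \<open>m\<close>, the size of
        the overlap; this cancels the overlap term of \<open>rank_Un\<close>.\<close>
      moreover have "?P N + ?P y \<le> ?P m + ?P (card (S i - U) + y)"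
        using P_sum_add_period[OF \<open>N > 0\<close>, of a y] subadd[of m "card (S i - U) + y"] card_m
        by (simp add: add.assoc[symmetric])
      ultimately show ?thesis
        using card_Un[of "S i - U"] by (simp add: add.assoc)
    qed
    ultimately have "good (U \<union> (S i - U))"
      by (simp add: good_def)
    then have "card (S i - U) = 0"
      using U_max card_Un[of "S i - U"] by fastforce
    then show False
      using i(2) by auto
  qed
  \<comment> \<open>Just enough new positions of \<open>S i\<close> are taken to reach size
    \<open>s\<close>.\<close>
  then obtain V where V: "V \<subseteq> S i - U" "card V = s - card U"
    by (metis obtain_subset_with_card_n less_imp_le le_diff_conv add.commute)
  have "\<rho> (U \<union> V) + ?P m \<le> \<rho> U + ?P m + ?P (card V)"
    using rank_Un[OF V(1)] subadd[of m "card V"] by simp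
  also have "\<dots> \<le> ?P (card U + card V) + ?P m"
    using U_inv[of "card V"] by simp
  finally have "\<rho> (U \<union> V) \<le> ?P s"
    using V \<open>card U \<le> s\<close> by simp
  moreover have "card (U \<union> V) = s"
    using card_Un[OF V(1)] V \<open>card U \<le> s\<close> by simp
  ultimately show ?thesis
    by blast
qed

section \<open>Linear algebra of restricted codes\<close>

text \<open>Over a finite field there are finitely many words, so every basis is finite. This gives
  access to the dimension formula for sums of subspaces.\<close>

interpretation finite_word: finite_dimensional_vector_space
  "wscale :: 'a::{field,finite} \<Rightarrow> 'a^'\<alpha>^'n \<Rightarrow> 'a^'\<alpha>^'n" "word.extend_basis {}"
  by unfold_locales
    (simp_all add: word.independent_extend_basis word.span_extend_basis word.independent_empty)

text \<open>The kernel of the restriction to \<open>T\<close> on \<open>C\<close>: the shortened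
  code, with its zeros kept.\<close>

definition vanishing :: "('a::field^'\<alpha>^'n) set \<Rightarrow> 'n set \<Rightarrow> ('a^'\<alpha>^'n) set" where
  "vanishing C T = {x \<in> C. \<forall>i\<in>T. x $ i = 0}"

text \<open>No generator matrix enters, so ranks of \<open>C\<close> and of its local codes, which
  come with different matrices, are directly comparable.\<close>

definition code_rank :: "('a::field^'\<alpha>^'n) set \<Rightarrow> 'n set \<Rightarrow> nat" where
  "code_rank C T = word.dim (restrict_word T ` C)"

lemma restrict_word_nth [simp]: "restrict_word T x $ i = (if i \<in> T then x $ i else 0)"
  by (simp add: restrict_word_def)

lemma linear_restrict_word: "Vector_Spaces.linear wscale wscale (restrict_word T)"
  by unfold_locales (simp_all add: vec_eq_iff wscale_def algebra_simps)

lemma restrict_word_restrict_word: "restrict_word T (restrict_word S x) = restrict_word (T \<inter> S) x"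
  by (simp add: vec_eq_iff)

lemma code_rank_punctured_code:
  "T \<subseteq> S \<Longrightarrow> code_rank (punctured_code C S) T = code_rank C T"
  by (simp add: code_rank_def punctured_code_def image_image restrict_word_restrict_word
      Int_absorb2)

lemma subspace_vanishing: "word.subspace C \<Longrightarrow> word.subspace (vanishing C T)"
  by (auto simp: vanishing_def word.subspace_def wscale_def)

lemma subspace_punctured_code: "word.subspace C \<Longrightarrow> word.subspace (punctured_code C S)"
  unfolding punctured_code_def
  by (rule module_hom.subspace_image[OF linear_restrict_word[unfolded linear_iff_module_hom]])

lemma thick_rank_eq_code_rank:
  assumes "generator_matrix C K G"
  shows "thick_rank K G T = code_rank C T"
proof -
  have "word.span (restrict_word T ` G ` {..<K}) = restrict_word T ` word.span (G ` {..<K})"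
    by (rule module_hom.span_image[OF linear_restrict_word[unfolded linear_iff_module_hom]])
  then show ?thesis
    using assms unfolding thick_rank_def code_rank_def generator_matrix_def by (metis word.dim_span)
qed

lemma code_rank_plus_dim_vanishing:
  fixes C :: "('a::{field,finite}^'\<alpha>^'n) set"
  assumes C: "word.subspace C"
  shows "code_rank C T + word.dim (vanishing C T) = word.dim C"
proof -
  \<comment> \<open>\<open>C\<close> and its restriction have the same sum with the space \<open>W\<close> of all words vanishing on \<open>T\<close>,
    but the restriction meets \<open>W\<close> trivially.\<close>
  let ?R = "restrict_word T ` C" and ?W = "vanishing (UNIV :: ('a^'\<alpha>^'n) set) T"
  have W: "word.subspace ?W"
    by (intro subspace_vanishing) simp
  have R: "word.subspace ?R"
    using subspace_punctured_code[OF C] by (simp add: punctured_code_def)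
  have "x - restrict_word T x \<in> ?W" "restrict_word T x - x \<in> ?W" for x
    by (simp_all add: vanishing_def)
  then have sums: "{x + y |x y. x \<in> C \<and> y \<in> ?W} = {x + y |x y. x \<in> ?R \<and> y \<in> ?W}"
  proof (intro set_eqI iffI; clarsimp)
    fix x y assume "x \<in> C" "y \<in> ?W"
    moreover have "x + y = restrict_word T x + (x - restrict_word T x + y)"
      by simp
    ultimately show "\<exists>u v. x + y = u + v \<and> u \<in> ?R \<and> v \<in> ?W"
      using \<open>x - restrict_word T x \<in> ?W\<close> word.subspace_add[OF W] by blast
  next
    fix x y assume "x \<in> C" "y \<in> ?W"
    moreover have "restrict_word T x + y = x + (restrict_word T x - x + y)"
      by simp
    ultimately show "\<exists>u v. restrict_word T x + y = u + v \<and> u \<in> C \<and> v \<in> ?W"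
      using \<open>restrict_word T x - x \<in> ?W\<close> word.subspace_add[OF W] by blast
  qed
  have "?R \<inter> ?W \<subseteq> {0}"
    by (auto simp: vanishing_def vec_eq_iff)
  then have "word.dim (?R \<inter> ?W) = 0"
    by simp
  moreover have CW: "C \<inter> ?W = vanishing C T"
    by (auto simp: vanishing_def)
  ultimately show ?thesis
    using finite_word.dim_sums_Int[OF C W] finite_word.dim_sums_Int[OF R W]
    unfolding sums CW code_rank_def by linarith
qed

lemma code_rank_empty [simp]:
  fixes C :: "('a::{field,finite}^'\<alpha>^'n) set"
  shows "code_rank C {} = 0"
  by (auto simp: code_rank_def vec_eq_iff)

lemma code_rank_mono:
  fixes C :: "('a::{field,finite}^'\<alpha>^'n) set"
  assumes "word.subspace C" "A \<subseteq> B"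
  shows "code_rank C A \<le> code_rank C B"
proof -
  have "word.dim (vanishing C B) \<le> word.dim (vanishing C A)"
    using assms(2) by (intro finite_word.dim_subset) (auto simp: vanishing_def)
  then show ?thesis
    using code_rank_plus_dim_vanishing[OF assms(1), of A]
      code_rank_plus_dim_vanishing[OF assms(1), of B] by linarith
qed

text \<open>The dimension formula is applied to the kernels for \<open>A\<close> and
  \<open>B\<close>: their sum lies in the kernel for \<open>A \<inter> B\<close>, their intersection
  is the kernel for \<open>A \<union> B\<close>. Rank-nullity reverses the inequality.\<close>

lemma code_rank_submodular:
  fixes C :: "('a::{field,finite}^'\<alpha>^'n) set"
  assumes C: "word.subspace C"
  shows "code_rank C (A \<union> B) + code_rank C (A \<inter> B) \<le> code_rank C A + code_rank C B"
proof -
  let ?Z = "vanishing C"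
  have "{x + y |x y. x \<in> ?Z A \<and> y \<in> ?Z B} \<subseteq> ?Z (A \<inter> B)"
    using word.subspace_add[OF C] by (auto simp: vanishing_def)
  then have "word.dim {x + y |x y. x \<in> ?Z A \<and> y \<in> ?Z B} \<le> word.dim (?Z (A \<inter> B))"
    by (rule finite_word.dim_subset)
  moreover have "?Z A \<inter> ?Z B = ?Z (A \<union> B)"
    by (auto simp: vanishing_def)
  ultimately have "word.dim (?Z A) + word.dim (?Z B)
      \<le> word.dim (?Z (A \<inter> B)) + word.dim (?Z (A \<union> B))"
    using finite_word.dim_sums_Int[of "?Z A" "?Z B"] subspace_vanishing[OF C] by simp
  then show ?thesis
    using code_rank_plus_dim_vanishing[OF C, of A] code_rank_plus_dim_vanishing[OF C, of B]
      code_rank_plus_dim_vanishing[OF C, of "A \<union> B"]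
      code_rank_plus_dim_vanishing[OF C, of "A \<inter> B"] by linarith
qed

lemma code_rank_less_dim_iff:
  fixes C :: "('a::{field,finite}^'\<alpha>^'n) set"
  assumes "word.subspace C"
  shows "code_rank C T < word.dim C \<longleftrightarrow> (\<exists>x\<in>C. x \<noteq> 0 \<and> (\<forall>i\<in>T. x $ i = 0))"
proof -
  have "code_rank C T < word.dim C \<longleftrightarrow> word.dim (vanishing C T) \<noteq> 0"
    using code_rank_plus_dim_vanishing[OF assms, of T] by linarith
  then show ?thesis
    by (auto simp: vanishing_def)
qed

section \<open>Minimum distance and ranks of local codes\<close>

lemma min_distance_le:
  assumes "x \<in> C" "x \<noteq> 0"
  shows "min_distance C \<le> hamming_weight x"
  unfolding min_distance_def using assms by (intro cInf_lower) auto

text \<open>A rank deficit on \<open>T\<close> leaves a nonzero codeword whose support is disjoint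
  from \<open>T\<close>.\<close>

lemma min_distance_add_card_le:
  fixes C :: "('a::{field,finite}^'\<alpha>^'n) set"
  assumes "word.subspace C" "code_rank C T < word.dim C"
  shows "min_distance C + card T \<le> CARD('n)"
proof -
  obtain x where x: "x \<in> C" "x \<noteq> 0" "\<forall>i\<in>T. x $ i = 0"
    using assms code_rank_less_dim_iff by blast
  have "hamming_weight x + card T = card ({i. x $ i \<noteq> 0} \<union> T)"
    unfolding hamming_weight_def using x(3) by (intro card_Un_disjoint[symmetric]) auto
  also have "\<dots> \<le> CARD('n)"
    by (intro card_mono) auto
  finally show ?thesis
    using min_distance_le[OF x(1,2)] by linarith
qed

text \<open>
  A positive minimum distance does not imply that the code is nonzero: \<open>Inf {}\<close> on \<open>nat\<close> is
  \<open>LEAST n. False\<close>, whose value is unspecified. That the local codes are nonzero comes from the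
  independence of the thick columns.
\<close>

lemma min_distance_attained:
  assumes "\<not> C \<subseteq> {0}"
  obtains x where "x \<in> C" "x \<noteq> 0" "hamming_weight x = min_distance C"
proof -
  have "hamming_weight ` (C - {0}) \<noteq> {}"
    using assms by auto
  then have "min_distance C \<in> hamming_weight ` (C - {0})"
    unfolding min_distance_def by (rule Inf_nat_def1)
  then obtain x where "min_distance C = hamming_weight x" "x \<in> C - {0}"
    by (rule imageE)
  then show ?thesis
    using that[of x] by simp
qed

lemma exists_codeword_nonzero_at:
  fixes C :: "('a::field^'\<alpha>^'n) set"
  assumes "generator_matrix C K G" "thick_columns_independent K G"
  obtains x where "x \<in> C" "x $ i \<noteq> 0"
proof -
  have "\<exists>k<K. G k $ i \<noteq> 0"
  proof (rule ccontr)
    assume "\<not> ?thesis"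
    \<comment> \<open>If all rows vanished at \<open>i\<close>, the all-ones coefficients would be a
      nontrivial relation between the columns there.\<close>
    then have "\<forall>k<K. (\<Sum>j\<in>UNIV. 1 * G k $ i $ j) = 0"
      by simp
    with assms(2) have "\<forall>j :: '\<alpha>. (1 :: 'a) = 0"
      unfolding thick_columns_independent_def by (elim allE[of _ i] allE[of _ "\<lambda>_. 1"]) blast
    then show False
      by simp
  qed
  then obtain k where "k < K" "G k $ i \<noteq> 0"
    by blast
  moreover have "G k \<in> C"
    using assms(1) \<open>k < K\<close> word.span_base[of "G k" "G ` {..<K}"]
    by (simp add: generator_matrix_def)
  ultimately show ?thesis
    using that by blast
qed

text \<open>Restricting first to \<open>I\<close> and then to \<open>T\<close> is restricting to
  \<open>T\<close>, so the local profile gives ranks of \<open>C\<close> itself. The profile speaks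
  of sizes from 1 on; the empty set is a separate case.\<close>

lemma URA_code_rank:
  fixes C :: "('a::{field,finite}^'\<alpha>^'n) set"
  assumes "URA_code I (punctured_code C I) a" "T \<subseteq> I"
  shows "code_rank C T = P_sum a (card I) (card T)"
proof (cases "T = {}")
  case False
  obtain k G' where G': "generator_matrix (punctured_code C I) k G'"
    and rank: "\<forall>i\<in>{1..card I}. \<forall>T. T \<subseteq> I \<and> card T = i \<longrightarrow> thick_rank k G' T = (\<Sum>j=1..i. a j)"
    using assms(1) unfolding URA_code_def by blast
  have "card T \<in> {1..card I}"
    using False assms(2) by (auto simp: card_mono Suc_le_eq card_gt_0_iff)
  then have "thick_rank k G' T = (\<Sum>j=1..card T. a j)" "card T \<le> card I"
    using rank assms(2) by auto
  then show ?thesis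
    by (simp add: thick_rank_eq_code_rank[OF G'] code_rank_punctured_code[OF assms(2)]
        P_sum_eq_sum)
qed simp

text \<open>\<open>T\<close> is the zero set within \<open>I\<close> of a local codeword of minimum
  weight; this word witnesses the loss of rank.\<close>

lemma exists_code_rank_less:
  fixes C :: "('a::{field,finite}^'\<alpha>^'n) set"
  assumes C: "word.subspace C" and nonzero: "\<not> punctured_code C I \<subseteq> {0}"
  obtains T where "T \<subseteq> I" "card T + min_distance (punctured_code C I) = card I"
    "code_rank C T < code_rank C I"
proof -
  obtain x where x: "x \<in> punctured_code C I" "x \<noteq> 0"
    "hamming_weight x = min_distance (punctured_code C I)"
    using min_distance_attained[OF nonzero] by blast
  let ?T = "{i \<in> I. x $ i = 0}"
  have "{i. x $ i \<noteq> 0} \<subseteq> I"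
    using x(1) by (auto simp: punctured_code_def split: if_splits)
  then have "?T \<union> {i. x $ i \<noteq> 0} = I"
    by auto
  then have "card ?T + hamming_weight x = card I"
    unfolding hamming_weight_def
    by (subst card_Un_disjoint[symmetric]) (simp_all add: disjoint_iff)
  moreover have "code_rank (punctured_code C I) ?T < word.dim (punctured_code C I)"
    using code_rank_less_dim_iff[OF subspace_punctured_code[OF C]] x(1,2) by blast
  then have "code_rank C ?T < code_rank C I"
    by (subst (asm) code_rank_punctured_code) (auto simp: code_rank_def punctured_code_def)
  ultimately show ?thesis
    using that[of ?T] x(3) by auto
qed

section \<open>The distance bound and its form when \<open>K_L\<close> divides
  \<open>K\<close>\<close>

theorem theoremV1:
  fixes C :: "('a::{field,finite}^'\<alpha>::finite^'n::finite) set"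
    and G :: "nat \<Rightarrow> 'a^'\<alpha>^'n"
    and n K d_min \<alpha> \<kappa> r \<delta> n_L K_L :: nat
    and L :: "'l set" and S :: "'l \<Rightarrow> 'n set"
    and a :: "nat \<Rightarrow> nat"
  assumes code: "vector_code C G n K d_min \<alpha> \<kappa>"
    and delta: "\<delta> \<ge> 2"
    and locality: "exact_information_locality C K G r \<delta> L S"
    and n_L: "n_L = r + \<delta> - 1"
    and URA: "\<forall>i\<in>L. URA_code (S i) (punctured_code C (S i)) a"
    and K_L: "K_L = (\<Sum>i=1..n_L. a i)"
  shows "int d_min \<le> int n - int (P_inv a n_L K) + 1
    \<and> (K_L dvd K \<longrightarrow>
         int d_min \<le> int n - int (K div K_L) * int r + 1
                       - (int (K div K_L) - 1) * (int \<delta> - 1))"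
proof -
  let ?P = "P_sum a n_L"
  have C: "word.subspace C" and gen: "generator_matrix C K G" and n: "n = CARD('n)"
    and K: "K = word.dim C" and d: "d_min = min_distance C"
    and columns: "thick_columns_independent K G"
    using code unfolding vector_code_def vector_code_on_def by blast+
  have nonzero_at: "\<exists>x\<in>C. x $ j \<noteq> 0" for j
    using exists_codeword_nonzero_at[OF gen columns] by blast
  then obtain x where "x \<in> C" "x $ undefined \<noteq> 0"
    by blast
  then have "K \<noteq> 0"
    unfolding K by auto
  have rank_K: "code_rank C (\<Union>i\<in>L. S i) = K"
    using locality by (simp add: exact_information_locality_def thick_rank_eq_code_rank[OF gen])
  have card_S: "card (S i) = n_L" and dist_S: "min_distance (punctured_code C (S i)) = \<delta>"
    if "i \<in> L" for i
    using locality that by (auto simp: exact_information_locality_def n_L)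
  have uniform: "code_rank C T = ?P (card T)" if "i \<in> L" "T \<subseteq> S i" for i T
    using URA_code_rank[of "S i" C a T] URA that card_S by simp
  have "L \<noteq> {}"
    using rank_K \<open>K \<noteq> 0\<close> by auto
  then obtain i where i: "i \<in> L"
    by blast
  have "S i \<noteq> {}"
    using card_S[OF i] n_L delta by auto
  then obtain j where "j \<in> S i"
    by blast
  moreover obtain x where "x \<in> C" "x $ j \<noteq> 0"
    using nonzero_at by blast
  ultimately have "\<exists>y\<in>punctured_code C (S i). y $ j \<noteq> 0"
    by (auto simp: punctured_code_def)
  then have "\<not> punctured_code C (S i) \<subseteq> {0}"
    by auto
  then obtain T where T: "T \<subseteq> S i" "card T + \<delta> = n_L" "code_rank C T < code_rank C (S i)"
    using exists_code_rank_less[OF C, of "S i"] unfolding card_S[OF i] dist_S[OF i] by blast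
  \<comment> \<open>Since \<open>n_L = r + \<delta> - 1\<close>, the size of \<open>T\<close> is one
    less than \<open>r\<close>, which also forces \<open>r\<close> to be positive.\<close>
  then have r: "card T = r - 1" "r \<ge> 1" "n_L > 0"
    using delta n_L by auto
  have P_n_L: "?P n_L = K_L"
    by (simp add: P_sum_eq_sum K_L)
  have P_less: "?P (r - 1) < K_L"
    using uniform[OF i T(1)] uniform[OF i subset_refl] T(3) card_S[OF i] r(1) P_n_L by simp
  \<comment> \<open>\<open>K_L\<close> is positive by \<open>P_less\<close>, so \<open>K\<close>
    periods reach \<open>K\<close> and \<open>P_inv\<close> is a genuine minimum.\<close>
  have "K \<le> K * K_L"
    using P_less by simp
  then have P_large: "K \<le> ?P (K * n_L)"
    using P_sum_mult_period_add[OF \<open>n_L > 0\<close>, of a K 0] P_n_L by simp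
  have "?P 0 < K"
    using \<open>K \<noteq> 0\<close> by simp
  then have P_inv_pos: "P_inv a n_L K > 0"
    using P_inv_le_iff[OF P_large, of 0] by simp
  \<comment> \<open>This is the largest size at which \<open>P_sum\<close> is still below
    \<open>K\<close>; positivity keeps the subtraction from truncating.\<close>
  have "\<not> P_inv a n_L K \<le> P_inv a n_L K - 1"
    using P_inv_pos by simp
  then have less: "?P (P_inv a n_L K - 1) < K"
    unfolding P_inv_le_iff[OF P_large] by simp
  then have "\<exists>U. card U = P_inv a n_L K - 1 \<and> code_rank C U \<le> ?P (P_inv a n_L K - 1)"
    using code_rank_submodular[OF C] code_rank_mono[OF C] card_S \<open>n_L > 0\<close> uniform rank_K
    by (intro exists_set_of_bounded_rank[where S = S and L = L]) auto
  then obtain U where U: "card U = P_inv a n_L K - 1" "code_rank C U < word.dim C"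
    using less K by auto
  have bound: "d_min + P_inv a n_L K \<le> n + 1"
    using min_distance_add_card_le[OF C U(2)] U(1) P_inv_pos d n by linarith
  have "int d_min \<le> int n - int (K div K_L) * int r + 1
      - (int (K div K_L) - 1) * (int \<delta> - 1)" if dvd: "K_L dvd K"
  proof -
    obtain q where q: "K div K_L = Suc q"
      using dvd \<open>K \<noteq> 0\<close> by (metis dvd_div_eq_0_iff not0_implies_Suc)
    then have "K = Suc q * K_L"
      using dvd by (metis dvd_div_mult_self)
    \<comment> \<open>After \<open>q\<close> full periods exactly \<open>K_L\<close> is missing, and
      by \<open>P_less\<close> another \<open>r - 1\<close> terms do not supply it. Hence
      \<open>P_inv\<close> is at least \<open>q * n_L + r\<close>.\<close>
    moreover have "?P (q * n_L + (r - 1)) = q * K_L + ?P (r - 1)"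
      using P_sum_mult_period_add[OF \<open>n_L > 0\<close>] P_n_L by simp
    ultimately have "?P (q * n_L + (r - 1)) < K"
      using P_less by simp
    then have "P_inv a n_L K > q * n_L + (r - 1)"
      using P_inv_le_iff[OF P_large] by (metis not_le)
    then have "d_min + (q * n_L + r) \<le> n + 1"
      using bound r(2) by linarith
    then have "int d_min + (int q * int n_L + int r) \<le> int n + 1"
      by (metis of_nat_add of_nat_le_iff of_nat_mult of_nat_1)
    moreover have "int n_L = int r + int \<delta> - 1"
      using n_L delta by simp
    ultimately show ?thesis
      using q by (simp add: algebra_simps)
  qed
  then show ?thesis
    using bound by linarith
qed

end
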